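(* Let $F,F'\in\mathcal{S}_1$ be two independent functions and let $F''=\{F,F'\}$. Let $\mathbf{a},\mathbf{a}',\mathbf{a}''\in\mathbb{R}^3$ be the corresponding coefficient vectors, $a,a',a''$ the corresponding pairs of antipodal points on the unit sphere, and $\alpha,\alpha',\alpha''$ the great circles dual to $a,a',a''$ respectively. Then the antipodal points of the pair $a''$ are the intersection of the two great circles $\alpha$ and $\alpha'$, and $\alpha''$ is the great circle joining the two pairs of points $a$ and $a'$.
   Context: $\mathcal{S}_1=\{Xf_1+Yf_2+Zf_3:(X,Y,Z)\in\mathbb{R}^3\}$ where $f_1=\sin\theta\cos\phi$, $f_2=\sin\theta\sin\phi$, $f_3=\cos\theta$ are functions on the unit sphere $S^2\subset\mathbb{R}^3$ (with $x=\sin\theta\cos\phi$, $y=\sin\theta\sin\phi$, $z=\cos\theta$). The coefficient vector of $F=Xf_1+Yf_2+Zf_3$ is $(X,Y,Z)$. The Poisson bracket is $\{F,F'\}=\frac{1}{\sin\theta}\left(\frac{\partial F}{\partial\theta}\frac{\partial F'}{\partial\phi}-\frac{\partial F}{\partial\phi}\frac{\partial F'}{\partial\theta}\right)$; it maps $\mathcal{S}_1\times\mathcal{S}_1$ to $\mathcal{S}_1$. Two functions are independent if their Poisson bracket is non zero. With a non zero vector $\mathbf{a}\in\mathbb{R}^3$ one associates the pair of antipodal points $a=(\mathsf{a},-\mathsf{a})$ on the unit sphere, where $\mathsf{a}$ is $\mathbf{a}$ divided by its Euclidean length. A pair of antipodal points and a great circle are dual to each other if the great circle is equidistant from the two points.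 *)

theory Defs
  imports "HOL-Analysis.Analysis"
begin

abbreviation S2 :: "(real^3) set" where
  "S2 \<equiv> sphere 0 1"

definition sph :: "real \<Rightarrow> real \<Rightarrow> real^3" where
  "sph \<theta> \<phi> = vector [sin \<theta> * cos \<phi>, sin \<theta> * sin \<phi>, cos \<theta>]"

(* A function on the unit sphere is an element of extensional S2, so that
   two such functions are equal iff they agree on S2. *)

definition f1 :: "real^3 \<Rightarrow> real" where "f1 = (\<lambda>p\<in>S2. p $ 1)"
definition f2 :: "real^3 \<Rightarrow> real" where "f2 = (\<lambda>p\<in>S2. p $ 2)"
definition f3 :: "real^3 \<Rightarrow> real" where "f3 = (\<lambda>p\<in>S2. p $ 3)"

lemma sph_in_S2: "sph \<theta> \<phi> \<in> S2"
proof -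
  have "(sin \<theta> * cos \<phi>)\<^sup>2 + (sin \<theta> * sin \<phi>)\<^sup>2 = (sin \<theta>)\<^sup>2 * ((cos \<phi>)\<^sup>2 + (sin \<phi>)\<^sup>2)"
    by (simp only: power_mult_distrib distrib_left)
  then have "(sin \<theta> * cos \<phi>)\<^sup>2 + (sin \<theta> * sin \<phi>)\<^sup>2 + (cos \<theta>)\<^sup>2 = 1"
    by (simp add: sin_cos_squared_add2)
  then show ?thesis
    by (simp add: sph_def norm_vec_def L2_set_def sum_3)
qed

lemma f_sph:
  "f1 (sph \<theta> \<phi>) = sin \<theta> * cos \<phi>"
  "f2 (sph \<theta> \<phi>) = sin \<theta> * sin \<phi>"
  "f3 (sph \<theta> \<phi>) = cos \<theta>"
  using sph_in_S2[of \<theta> \<phi>] by (simp_all add: f1_def f2_def f3_def sph_def)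

definition lin_comb :: "real \<Rightarrow> real \<Rightarrow> real \<Rightarrow> real^3 \<Rightarrow> real" where
  "lin_comb X Y Z = (\<lambda>p\<in>S2. X * f1 p + Y * f2 p + Z * f3 p)"

definition S1 :: "(real^3 \<Rightarrow> real) set" where
  "S1 = {lin_comb X Y Z | X Y Z. True}"

definition coeff_vector :: "(real^3 \<Rightarrow> real) \<Rightarrow> real^3" where
  "coeff_vector F = (THE v. F = lin_comb (v $ 1) (v $ 2) (v $ 3))"

definition bracket_formula ::
  "(real^3 \<Rightarrow> real) \<Rightarrow> (real^3 \<Rightarrow> real) \<Rightarrow> real \<Rightarrow> real \<Rightarrow> real" where
  "bracket_formula F G \<theta> \<phi> =
     1 / sin \<theta> *
      (deriv (\<lambda>t. F (sph t \<phi>)) \<theta> * deriv (\<lambda>s. G (sph \<theta> s)) \<phi>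
       - deriv (\<lambda>s. F (sph \<theta> s)) \<phi> * deriv (\<lambda>t. G (sph t \<phi>)) \<theta>)"

(* The coordinate formula is meaningless at the poles (sin \<theta> = 0); there the
   bracket is given by continuity.  For smooth F and G such an H exists, and it
   is unique because the sphere without its poles is dense in S2. *)
definition poisson ::
  "(real^3 \<Rightarrow> real) \<Rightarrow> (real^3 \<Rightarrow> real) \<Rightarrow> real^3 \<Rightarrow> real" where
  "poisson F G = (THE H. H \<in> extensional S2 \<and> continuous_on S2 H \<and>
     (\<forall>\<theta>\<in>{0<..<pi}. \<forall>\<phi>. H (sph \<theta> \<phi>) = bracket_formula F G \<theta> \<phi>))"

definition independent_functions :: "(real^3 \<Rightarrow> real) \<Rightarrow> (real^3 \<Rightarrow> real) \<Rightarrow> bool" where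
  "independent_functions F G \<longleftrightarrow> (\<exists>p\<in>S2. poisson F G p \<noteq> 0)"

(* Meaningful for v \<noteq> 0 only. *)
definition antipodal_pair :: "real^3 \<Rightarrow> (real^3) set" where
  "antipodal_pair v = {v /\<^sub>R norm v, - (v /\<^sub>R norm v)}"

definition great_circle :: "(real^3) set \<Rightarrow> bool" where
  "great_circle C \<longleftrightarrow> (\<exists>n. n \<noteq> 0 \<and> C = {p \<in> S2. n \<bullet> p = 0})"

(* Equidistance of points of S2 is the same for the chordal distance dist and
   for the spherical distance, an increasing function of it. *)
definition dual :: "(real^3) set \<Rightarrow> (real^3) set \<Rightarrow> bool" where
  "dual P C \<longleftrightarrow> great_circle C \<and>
     (\<exists>q\<in>S2. P = {q, - q} \<and> (\<forall>p\<in>C. dist p q = dist p (- q)))"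

definition dual_circle :: "(real^3) set \<Rightarrow> (real^3) set" where
  "dual_circle P = (THE C. dual P C)"

definition joins :: "(real^3) set \<Rightarrow> (real^3) set \<Rightarrow> (real^3) set \<Rightarrow> bool" where
  "joins C P Q \<longleftrightarrow> great_circle C \<and> P \<subseteq> C \<and> Q \<subseteq> C"

end

theory Submission imports Defs begin

text \<open>
  A function in \<open>S1\<close> is the restriction to the sphere of a linear form \<open>p \<mapsto> v \<bullet> p\<close>, and
  \<open>v\<close> is its coefficient vector.  The point of the proof is that the Poisson bracket of two such
  functions is the linear form of the \<^emph>\<open>cross product\<close> of their coefficient vectors
  (\<open>poisson_linear_on_sphere\<close>): the partial derivatives pair \<open>v\<close> and \<open>w\<close> with the tangent vectors
  \<open>\<partial>\<^sub>\<theta>\<close> and \<open>\<partial>\<^sub>\<phi>\<close> at \<open>p\<close>, and the resulting two by two minor, divided by \<open>sin \<theta>\<close>, is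
  \<open>(v \<times> w) \<bullet> (\<partial>\<^sub>\<theta> \<times> \<partial>\<^sub>\<phi>) / sin \<theta> = (v \<times> w) \<bullet> p\<close>.

  Duality between antipodal pairs and great circles is orthogonality: the dual circle of the pair
  of \<open>v\<close> is the unit circle of the plane \<open>v \<bullet> p = 0\<close> (\<open>dual_circle_antipodal_pair\<close>).  Hence the
  proposition says that, for \<open>v \<times> w \<noteq> 0\<close>, the vectors orthogonal to both \<open>v\<close> and \<open>w\<close> are exactly
  the multiples of \<open>v \<times> w\<close> (\<open>orthogonal_to_both_imp_multiple_cross3\<close>).  Read for points \<open>p\<close> of the
  sphere, this describes the intersection of the two dual circles; read for normals \<open>n\<close> of planes,
  it describes the great circles through the two pairs.
\<close>

section \<open>Linear functions on the sphere\<close>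

definition linear_on_sphere :: "real^3 \<Rightarrow> real^3 \<Rightarrow> real" where
  "linear_on_sphere v = (\<lambda>p\<in>S2. v \<bullet> p)"

lemma lin_comb_eq_linear_on_sphere: "lin_comb X Y Z = linear_on_sphere (vector [X, Y, Z])"
  by (rule ext) (auto simp: lin_comb_def linear_on_sphere_def f1_def f2_def f3_def
      inner_vec_def sum_3)

lemma lin_comb_components: "lin_comb (v $ 1) (v $ 2) (v $ 3) = linear_on_sphere v"
proof -
  have "vector [v $ 1, v $ 2, v $ 3] = v"
    by (simp add: vec_eq_iff forall_3)
  then show ?thesis
    by (simp add: lin_comb_eq_linear_on_sphere)
qed

lemma linear_on_sphere_inj: "linear_on_sphere v = linear_on_sphere w \<longleftrightarrow> v = w"
proof
  assume eq: "linear_on_sphere v = linear_on_sphere w"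
  have "v $ i = w $ i" for i
  proof -
    have "linear_on_sphere v (axis i 1) = linear_on_sphere w (axis i 1)"
      by (simp only: eq)
    then show ?thesis
      by (simp add: linear_on_sphere_def inner_axis norm_axis_1)
  qed
  then show "v = w"
    by (simp add: vec_eq_iff)
qed simp

lemma coeff_vector_linear_on_sphere: "coeff_vector (linear_on_sphere v) = v"
  unfolding coeff_vector_def lin_comb_components linear_on_sphere_inj by simp

lemma S1_E:
  assumes "F \<in> S1"
  obtains v where "F = linear_on_sphere v"
  using assms by (auto simp: S1_def lin_comb_eq_linear_on_sphere)

lemma linear_on_sphere_sph:
  "linear_on_sphere v (sph \<theta> \<phi>) =
     v $ 1 * (sin \<theta> * cos \<phi>) + v $ 2 * (sin \<theta> * sin \<phi>) + v $ 3 * cos \<theta>"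
  using sph_in_S2[of \<theta> \<phi>]
  by (simp add: linear_on_sphere_def inner_vec_def sum_3 sph_def)

section \<open>The Poisson bracket as a cross product\<close>

lemma bracket_formula_linear_on_sphere:
  assumes "sin \<theta> \<noteq> 0"
  shows "bracket_formula (linear_on_sphere v) (linear_on_sphere w) \<theta> \<phi> =
           linear_on_sphere (cross3 v w) (sph \<theta> \<phi>)"
proof -
  have d\<theta>: "deriv (\<lambda>t. linear_on_sphere u (sph t \<phi>)) \<theta> =
      u $ 1 * (cos \<theta> * cos \<phi>) + u $ 2 * (cos \<theta> * sin \<phi>) - u $ 3 * sin \<theta>" for u
    unfolding linear_on_sphere_sph
    by (rule DERIV_imp_deriv) (auto intro!: derivative_eq_intros)
  have d\<phi>: "deriv (\<lambda>s. linear_on_sphere u (sph \<theta> s)) \<phi> =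
      sin \<theta> * (u $ 2 * cos \<phi> - u $ 1 * sin \<phi>)" for u
    unfolding linear_on_sphere_sph
    by (rule DERIV_imp_deriv) (auto intro!: derivative_eq_intros simp: algebra_simps)
  define A where "A u = u $ 1 * (cos \<theta> * cos \<phi>) + u $ 2 * (cos \<theta> * sin \<phi>) - u $ 3 * sin \<theta>"
    for u :: "real^3"
  define B where "B u = u $ 2 * cos \<phi> - u $ 1 * sin \<phi>" for u :: "real^3"
  have "bracket_formula (linear_on_sphere v) (linear_on_sphere w) \<theta> \<phi> = A v * B w - B v * A w"
    using assms by (simp add: bracket_formula_def d\<theta> d\<phi> A_def B_def field_simps)
  \<comment> \<open>The bilinear form on the right pairs \<open>v \<times> w\<close> with the vector product of the two unit
      tangent vectors, whose last component is \<open>cos \<theta>\<close> only after using \<open>sin\<^sup>2 \<phi> + cos\<^sup>2 \<phi> = 1\<close>.\<close>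
  also have "\<dots> = (v $ 2 * w $ 3 - v $ 3 * w $ 2) * (sin \<theta> * cos \<phi>)
      + (v $ 3 * w $ 1 - v $ 1 * w $ 3) * (sin \<theta> * sin \<phi>)
      + (v $ 1 * w $ 2 - v $ 2 * w $ 1) * (cos \<theta> * ((sin \<phi>)\<^sup>2 + (cos \<phi>)\<^sup>2))"
    unfolding A_def B_def by algebra
  also have "\<dots> = linear_on_sphere (cross3 v w) (sph \<theta> \<phi>)"
    by (simp add: linear_on_sphere_sph cross3_def)
  finally show ?thesis .
qed

lemma sph_surj:
  assumes "p \<in> S2"
  obtains \<theta> \<phi> where "\<theta> \<in> {0..pi}" and "p = sph \<theta> \<phi>"
proof -
  define c where "c = Complex (p $ 1) (p $ 2)"
  have "(p $ 1)\<^sup>2 + (p $ 2)\<^sup>2 + (p $ 3)\<^sup>2 = 1"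
    using assms by (simp add: norm_vec_def L2_set_def sum_3)
  then have "(p $ 3)\<^sup>2 + (cmod c)\<^sup>2 = 1"
    by (simp add: c_def cmod_power2)
  then obtain \<theta> where \<theta>: "0 \<le> \<theta>" "\<theta> \<le> pi" "p $ 3 = cos \<theta>" "cmod c = sin \<theta>"
    using sincos_total_pi[of "cmod c" "p $ 3"] by auto
  have "c = rcis (sin \<theta>) (Arg c)"
    by (metis rcis_cmod_Arg \<theta>(4))
  then have "p $ 1 = sin \<theta> * cos (Arg c)" "p $ 2 = sin \<theta> * sin (Arg c)"
    by (metis c_def complex.sel(1) Re_rcis, metis c_def complex.sel(2) Im_rcis)
  with \<theta> have "p = sph \<theta> (Arg c)"
    by (simp add: sph_def vec_eq_iff forall_3)
  with \<theta> show ?thesis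
    by (intro that) auto
qed

lemma continuous_on_sph: "continuous_on A (\<lambda>t. sph t \<phi>)"
proof -
  have "continuous_on A (\<lambda>t. \<chi> i. sph t \<phi> $ i)"
  proof (rule continuous_on_vec_lambda)
    have "continuous_on A (\<lambda>t. sph t \<phi> $ 1)" "continuous_on A (\<lambda>t. sph t \<phi> $ 2)"
      "continuous_on A (\<lambda>t. sph t \<phi> $ 3)"
      unfolding sph_def vector_3 by (intro continuous_intros)+
    then show "continuous_on A (\<lambda>t. sph t \<phi> $ i)" for i
      using exhaust_3[of i] by metis
  qed
  then show ?thesis
    by simp
qed

text \<open>
  Every point, poles included, lies on a meridian \<open>t \<mapsto> sph t \<phi>\<close>, \<open>t \<in> {0..pi}\<close>; so it suffices to
  pass to the endpoints of the open interval along a meridian.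
\<close>
lemma continuous_extension_over_poles_unique:
  fixes G H :: "real^3 \<Rightarrow> real"
  assumes "continuous_on S2 G" "continuous_on S2 H"
    and eq: "\<And>\<theta> \<phi>. \<theta> \<in> {0<..<pi} \<Longrightarrow> G (sph \<theta> \<phi>) = H (sph \<theta> \<phi>)"
    and "p \<in> S2"
  shows "G p = H p"
proof -
  obtain \<theta> \<phi> where \<theta>: "\<theta> \<in> {0..pi}" and p: "p = sph \<theta> \<phi>"
    using sph_surj \<open>p \<in> S2\<close> .
  have cont: "continuous_on A (\<lambda>t. K (sph t \<phi>))"
    if "continuous_on S2 K" for A and K :: "real^3 \<Rightarrow> real"
    by (rule continuous_on_compose2[OF that continuous_on_sph]) (use sph_in_S2 in auto)
  have "G (sph \<theta> \<phi>) - H (sph \<theta> \<phi>) = 0"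
  proof (rule continuous_constant_on_closure[where S = "{0<..<pi}"
        and f = "\<lambda>t. G (sph t \<phi>) - H (sph t \<phi>)"])
    show "continuous_on (closure {0<..<pi}) (\<lambda>t. G (sph t \<phi>) - H (sph t \<phi>))"
      by (intro continuous_on_diff cont assms)
  qed (use eq \<theta> in auto)
  with p show ?thesis
    by simp
qed

lemma poisson_linear_on_sphere:
  "poisson (linear_on_sphere v) (linear_on_sphere w) = linear_on_sphere (cross3 v w)"
  unfolding poisson_def
proof (rule the_equality)
  have cont: "continuous_on S2 (linear_on_sphere (cross3 v w))"
  proof -
    have "continuous_on S2 (\<lambda>p. cross3 v w \<bullet> p)"
      by (intro continuous_intros)
    then show ?thesis
      by (rule continuous_on_eq) (simp add: linear_on_sphere_def)
  qed
  have formula: "linear_on_sphere (cross3 v w) (sph \<theta> \<phi>) =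
      bracket_formula (linear_on_sphere v) (linear_on_sphere w) \<theta> \<phi>"
    if "\<theta> \<in> {0<..<pi}" for \<theta> \<phi>
    using that sin_gt_zero[of \<theta>] by (simp add: bracket_formula_linear_on_sphere)
  have ext: "linear_on_sphere (cross3 v w) \<in> extensional S2"
    by (simp add: linear_on_sphere_def)
  show "linear_on_sphere (cross3 v w) \<in> extensional S2 \<and>
      continuous_on S2 (linear_on_sphere (cross3 v w)) \<and>
      (\<forall>\<theta>\<in>{0<..<pi}. \<forall>\<phi>. linear_on_sphere (cross3 v w) (sph \<theta> \<phi>) =
        bracket_formula (linear_on_sphere v) (linear_on_sphere w) \<theta> \<phi>)"
    using ext cont formula by blast
  fix H
  assume H: "H \<in> extensional S2 \<and> continuous_on S2 H \<and>
     (\<forall>\<theta>\<in>{0<..<pi}. \<forall>\<phi>. H (sph \<theta> \<phi>) =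
        bracket_formula (linear_on_sphere v) (linear_on_sphere w) \<theta> \<phi>)"
  show "H = linear_on_sphere (cross3 v w)"
  proof (rule extensionalityI)
    show "H p = linear_on_sphere (cross3 v w) p" if "p \<in> S2" for p
      by (rule continuous_extension_over_poles_unique[OF _ cont _ that]) (use H formula in auto)
  qed (use H ext in auto)
qed

lemma independent_functions_imp_cross3_nonzero:
  assumes "independent_functions (linear_on_sphere v) (linear_on_sphere w)"
  shows "cross3 v w \<noteq> 0"
  using assms unfolding independent_functions_def poisson_linear_on_sphere
  by (auto simp: linear_on_sphere_def)

section \<open>Duality of antipodal pairs and great circles\<close>

definition polar_circle :: "real^3 \<Rightarrow> (real^3) set" where
  "polar_circle n = {p \<in> S2. n \<bullet> p = 0}"

lemma great_circle_polar_circle: "n \<noteq> 0 \<Longrightarrow> great_circle (polar_circle n)"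
  by (auto simp: great_circle_def polar_circle_def)

lemma great_circleE:
  assumes "great_circle C"
  obtains n where "n \<noteq> 0" and "C = polar_circle n"
  using assms by (auto simp: great_circle_def polar_circle_def)

lemma polar_circle_scaleR: "c \<noteq> 0 \<Longrightarrow> polar_circle (c *\<^sub>R n) = polar_circle n"
  by (auto simp: polar_circle_def)

text \<open>
  If the part of \<open>q\<close> orthogonal to \<open>n\<close> were nonzero, then, scaled to length one, it would be a
  point of the first circle; so it would be orthogonal to \<open>q\<close>, and therefore to itself.
\<close>
lemma polar_circle_subset_imp_eq:
  assumes sub: "polar_circle n \<subseteq> polar_circle q" and "n \<noteq> 0" "q \<noteq> 0"
  shows "polar_circle n = polar_circle q"
proof -
  define c where "c = (n \<bullet> q) / (n \<bullet> n)"
  define r where "r = q - c *\<^sub>R n"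
  have nr: "n \<bullet> r = 0"
    using \<open>n \<noteq> 0\<close> by (simp add: r_def c_def inner_diff_right)
  have "r = 0"
  proof (rule ccontr)
    assume "r \<noteq> 0"
    then have "r /\<^sub>R norm r \<in> polar_circle n"
      using nr by (simp add: polar_circle_def)
    with sub have "r /\<^sub>R norm r \<in> polar_circle q"
      by (rule subsetD)
    then have "q \<bullet> (r /\<^sub>R norm r) = 0"
      unfolding polar_circle_def by (elim CollectE conjE)
    then have "q \<bullet> r = 0"
      using \<open>r \<noteq> 0\<close> by simp
    moreover have "r \<bullet> r = q \<bullet> r - c * (n \<bullet> r)"
      by (subst (1) r_def) (simp add: inner_diff_left)
    ultimately show False
      using nr \<open>r \<noteq> 0\<close> by simp
  qed
  then have "q = c *\<^sub>R n"
    by (simp add: r_def)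
  with \<open>q \<noteq> 0\<close> show ?thesis
    by (auto simp: polar_circle_scaleR)
qed

lemma equidistant_antipodes_iff:
  fixes p q :: "'a::real_inner"
  shows "dist p q = dist p (- q) \<longleftrightarrow> q \<bullet> p = 0"
proof -
  have "dist p q = dist p (- q) \<longleftrightarrow> (norm (p - q))\<^sup>2 = (norm (p + q))\<^sup>2"
    by (simp add: dist_norm)
  also have "\<dots> \<longleftrightarrow> q \<bullet> p = 0"
    unfolding power2_norm_eq_inner by (simp add: algebra_simps inner_commute)
  finally show ?thesis .
qed

text \<open>
  Equidistance constrains only the points of \<open>C\<close>, so it yields an inclusion; a great circle
  contained in another one is equal to it.
\<close>
lemma dual_antipodes_iff:
  assumes "q \<in> S2"
  shows "dual {q, - q} C \<longleftrightarrow> C = polar_circle q"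
proof
  assume "dual {q, - q} C"
  then obtain q' where C: "great_circle C" and q': "q' \<in> S2" "{q, - q} = {q', - q'}"
    and eqd: "\<forall>p\<in>C. dist p q' = dist p (- q')"
    by (auto simp: dual_def)
  obtain n where n: "n \<noteq> 0" "C = polar_circle n"
    using C great_circleE by blast
  have "q' \<noteq> 0"
    using q' by auto
  have "C \<subseteq> polar_circle q'"
    using eqd n by (auto simp: equidistant_antipodes_iff polar_circle_def)
  then have "C = polar_circle q'"
    using n \<open>q' \<noteq> 0\<close> polar_circle_subset_imp_eq by blast
  moreover have "q' = q \<or> q' = - q"
    using q' by (auto simp: doubleton_eq_iff)
  ultimately show "C = polar_circle q"
    using polar_circle_scaleR[of "- 1" q] by auto
next
  assume "C = polar_circle q"
  moreover have "q \<noteq> 0"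
    using assms by auto
  ultimately show "dual {q, - q} C"
    using assms great_circle_polar_circle[of q]
    by (auto simp: dual_def equidistant_antipodes_iff polar_circle_def)
qed

lemma dual_circle_antipodal_pair:
  assumes "v \<noteq> 0"
  shows "dual_circle (antipodal_pair v) = polar_circle v"
proof -
  have "v /\<^sub>R norm v \<in> S2"
    using assms by simp
  then have "dual_circle (antipodal_pair v) = polar_circle (v /\<^sub>R norm v)"
    by (simp only: dual_circle_def antipodal_pair_def dual_antipodes_iff the_eq_trivial)
  also have "\<dots> = polar_circle v"
    using assms by (intro polar_circle_scaleR) simp
  finally show ?thesis .
qed

lemma antipodal_pair_subset_polar_circle_iff:
  assumes "v \<noteq> 0"
  shows "antipodal_pair v \<subseteq> polar_circle n \<longleftrightarrow> n \<bullet> v = 0"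
  using assms by (auto simp: antipodal_pair_def polar_circle_def)

lemma unit_multiple_in_antipodal_pair:
  assumes "norm (c *\<^sub>R u) = 1"
  shows "c *\<^sub>R u \<in> antipodal_pair u"
proof -
  have "\<bar>c\<bar> * norm u = 1"
    using assms by simp
  then have "\<bar>c\<bar> = inverse (norm u)"
    by (metis inverse_unique mult.commute)
  then have "c = inverse (norm u) \<or> c = - inverse (norm u)"
    by linarith
  then show ?thesis
    by (auto simp: antipodal_pair_def)
qed

section \<open>Vectors orthogonal to two independent vectors\<close>

text \<open>
  The triple product expansion \<open>p \<times> (v \<times> w) = (p \<bullet> w) v - (p \<bullet> v) w\<close> makes \<open>p\<close> parallel to
  \<open>v \<times> w\<close>.
\<close>
lemma orthogonal_to_both_imp_multiple_cross3:
  assumes "cross3 v w \<noteq> 0" "p \<bullet> v = 0" "p \<bullet> w = 0"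
  obtains c where "p = c *\<^sub>R cross3 v w"
proof -
  have "cross3 (cross3 v w) p = 0"
    using assms by (simp add: Lagrange cross_skew[of "cross3 v w"])
  then have "collinear {0, cross3 v w, p}"
    by (simp add: cross_eq_0)
  with assms that show ?thesis
    by (auto simp: collinear_lemma)
qed

lemma polar_circle_Int_eq_antipodal_pair_cross3:
  assumes "cross3 v w \<noteq> 0"
  shows "polar_circle v \<inter> polar_circle w = antipodal_pair (cross3 v w)"
proof
  show "polar_circle v \<inter> polar_circle w \<subseteq> antipodal_pair (cross3 v w)"
  proof
    fix p assume p: "p \<in> polar_circle v \<inter> polar_circle w"
    then obtain c where c: "p = c *\<^sub>R cross3 v w"
      using orthogonal_to_both_imp_multiple_cross3[OF assms, of p]
      by (auto simp: polar_circle_def inner_commute)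
    moreover have "norm p = 1"
      using p by (simp add: polar_circle_def)
    ultimately show "p \<in> antipodal_pair (cross3 v w)"
      using unit_multiple_in_antipodal_pair by blast
  qed
  show "antipodal_pair (cross3 v w) \<subseteq> polar_circle v \<inter> polar_circle w"
    using assms by (simp add: antipodal_pair_subset_polar_circle_iff dot_cross_self)
qed

lemma joins_antipodal_pairs_iff:
  assumes "cross3 v w \<noteq> 0"
  shows "joins C (antipodal_pair v) (antipodal_pair w) \<longleftrightarrow> C = polar_circle (cross3 v w)"
proof
  have nz: "v \<noteq> 0" "w \<noteq> 0"
    using assms by auto
  show "C = polar_circle (cross3 v w)" if joins: "joins C (antipodal_pair v) (antipodal_pair w)"
  proof -
    obtain n where n: "n \<noteq> 0" "C = polar_circle n"
      using joins great_circleE by (auto simp: joins_def)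
    then have "n \<bullet> v = 0" "n \<bullet> w = 0"
      using joins nz by (auto simp: joins_def antipodal_pair_subset_polar_circle_iff)
    then obtain c where "n = c *\<^sub>R cross3 v w"
      using orthogonal_to_both_imp_multiple_cross3[OF assms] by blast
    with n show ?thesis
      by (auto simp: polar_circle_scaleR)
  qed
  show "joins C (antipodal_pair v) (antipodal_pair w)" if "C = polar_circle (cross3 v w)"
    using that assms nz
    by (simp add: joins_def great_circle_polar_circle antipodal_pair_subset_polar_circle_iff
        dot_cross_self)
qed

section \<open>Independent functions and spherical duality\<close>

theorem proposition1p4:
  fixes F F' F'' :: "real^3 \<Rightarrow> real"
    and v v' v'' :: "real^3"
    and a a' a'' \<alpha> \<alpha>' \<alpha>'' :: "(real^3) set"
  assumes "F \<in> S1" and "F' \<in> S1"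
    and "independent_functions F F'"
    and "F'' = poisson F F'"
    and "v = coeff_vector F" and "v' = coeff_vector F'" and "v'' = coeff_vector F''"
    and "a = antipodal_pair v" and "a' = antipodal_pair v'" and "a'' = antipodal_pair v''"
    and "\<alpha> = dual_circle a" and "\<alpha>' = dual_circle a'" and "\<alpha>'' = dual_circle a''"
  shows "a'' = \<alpha> \<inter> \<alpha>' \<and> joins \<alpha>'' a a' \<and> (\<forall>C. joins C a a' \<longrightarrow> C = \<alpha>'')"
proof -
  obtain u where F: "F = linear_on_sphere u"
    using assms(1) by (rule S1_E)
  obtain u' where F': "F' = linear_on_sphere u'"
    using assms(2) by (rule S1_E)
  have v: "v = u" "v' = u'" "v'' = cross3 u u'"
    using assms(4-7)
    by (simp_all add: F F' coeff_vector_linear_on_sphere poisson_linear_on_sphere)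
  have cross: "cross3 v v' \<noteq> 0" and v'': "v'' = cross3 v v'"
    using assms(3) independent_functions_imp_cross3_nonzero by (auto simp: F F' v)
  then have nz: "v \<noteq> 0" "v' \<noteq> 0" "v'' \<noteq> 0"
    by auto
  have \<alpha>: "\<alpha> = polar_circle v" "\<alpha>' = polar_circle v'" "\<alpha>'' = polar_circle v''"
    using assms(8-13) nz by (simp_all add: dual_circle_antipodal_pair)
  have "a'' = \<alpha> \<inter> \<alpha>'"
    using polar_circle_Int_eq_antipodal_pair_cross3[OF cross] assms(10) \<alpha> v'' by simp
  moreover have "joins C a a' \<longleftrightarrow> C = \<alpha>''" for C
    using joins_antipodal_pairs_iff[OF cross] assms(8,9) \<alpha> v'' by simp
  ultimately show ?thesis
    by simp
qed

end
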